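(* Let $\widehat{\mathbb{R}}$ be the set of all convergent sequences of real numbers, with the operations $\hat{+},\hat{\cdot}$, the relation $\hat{<}$, the shadow $\sigma$, indiscernibility $\approx$ and monads $m_{\approx}(\cdot)$ defined in the context. Then: a) $(\widehat{\mathbb{R}},\hat{<},\hat{+},\hat{\cdot},(0),(1))$ is a commutative ring with the constant sequences $(0)$ and $(1)$ as zero element and identity element, respectively. b) The shadow mapping $\sigma:\widehat{\mathbb{R}}\to\widehat{\mathbb{R}}$, $\sigma(x):=\sigma x$, is an idempotent ring endomorphism, i.e. for all $x,y\in\widehat{\mathbb{R}}$: $\sigma(\sigma x)=\sigma x$, $\sigma(x\hat{+}y)=\sigma x\,\hat{+}\,\sigma y$, $\sigma(x\,\hat{\cdot}\,y)=\sigma x\,\hat{\cdot}\,\sigma y$, and $\sigma(1)=(1)$. Furthermore, $\mathrm{Ker}(\sigma):=\{x\in\widehat{\mathbb{R}}\mid\sigma x=(0)\}=m_{\approx}((0))$ and $\sigma(\widehat{\mathbb{R}})=\{y\in\widehat{\mathbb{R}}\mid y\text{ is a constant sequence}\}$. c) $m_{\approx}((0))$ is a nonnull ideal; so the sum of infinitesimals is an infinitesimal, the additive inverse of an infinitesimal is an infinitesimal, $(0)$ is an infinitesimal, the product of an element of $\widehat{\mathbb{R}}$ and an infinitesimal is an infinitesimal, and there is a nonnull infinitesimal. d) The product of infinitesimals is always null: $x\,\hat{\cdot}\,y=(0)$ for all $x,y\in m_{\approx}((0))$. In particular each infinitesimal is nilpotent, since $x\,\hat{\cdot}\,x=(0)$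 for each $x\in m_{\approx}((0))$. e) An element of $\widehat{\mathbb{R}}$ has a multiplicative inverse if and only if it is not an infinitesimal. f) For all $x,y,z\in\widehat{\mathbb{R}}$: $\lnot(x\,\hat{<}\,x)$; $\ x\,\hat{<}\,y\wedge y\,\hat{<}\,z\Rightarrow x\,\hat{<}\,z$; $\ x\,\hat{<}\,y\vee x\approx y\vee y\,\hat{<}\,x$; $\ x\,\hat{<}\,y\Rightarrow x\,\hat{+}\,z\,\hat{<}\,y\,\hat{+}\,z$; $\ x\,\hat{<}\,y\wedge z\,\hat{>}\,(0)\Rightarrow x\,\hat{\cdot}\,z\,\hat{<}\,y\,\hat{\cdot}\,z$. (In this sense, with the third formula in the role of trichotomy, $\widehat{\mathbb{R}}$ may be considered an ordered ring.) g) $\widehat{\mathbb{R}}$ is archimedean: for all $x,y\in\widehat{\mathbb{R}}$, if $x\,\hat{>}\,(0)$ then there is $m\in\mathbb{N}$ with $\widehat{m}x\,\hat{>}\,y$, where $\widehat{m}x$ is the $m$-fold sum $x\,\hat{+}\cdots\hat{+}\,x$ (and $\widehat{1}x=x$). h) The mapping $\ast:\mathbb{R}\to\sigma(\widehat{\mathbb{R}})$, $\ast(\xi):=(\xi)$ (the constant sequence determined by $\xi$), is a ring isomorphism of $(\mathbb{R},<,+,\cdot,0,1)$ onto $(\sigma(\widehat{\mathbb{R}}),\hat{<},\hat{+},\hat{\cdot},(0),(1))$, and for all $\xi,\eta\in\mathbb{R}$: $\xi<\eta\Leftrightarrow\ast(\xi)\,\hat{<}\,\ast(\eta)$. So, using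 $\ast$, $\mathbb{R}$ can be embedded in $\widehat{\mathbb{R}}$.
   Context: $\widehat{\mathbb{R}}$ is the set of all sequences $x=(\xi_n)$ of real numbers that converge (in the usual sense); $\lim x\in\mathbb{R}$ is the limit. For $\xi \in\mathbb{R}$, $(\xi)$ is the constant sequence. The shadow of $x$ is the constant sequence $\sigma x:=(\lim x)$. Indiscernibility: $x\approx y$ iff $\sigma x=\sigma y$. The monad of $x$ is $m_{\approx}(x):=\{y\in\widehat{\mathbb{R}}\mid y\approx x\}$. An infinitesimal is an element of $m_{\approx}((0))$. For $x=(\xi_n),y=(\eta_n)\in\widehat{\mathbb{R}}$: $x\,\hat{+}\,y:=(\xi_n+\eta_n)$; $x\,\hat{\cdot}\,y:=(\lim x\cdot\eta_n+\lim y\cdot\xi_n-\lim x\cdot\lim y)$; $x\,\hat{<}\,y$ iff $\lim x<\lim y$; $x\,\hat{>}\,y$ iff $y\,\hat{<}\,x$. $\mathbb{N}$ is the set of positive integers. *)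

theory Defs
  imports
    Complex_Main
    "HOL-Algebra.Ideal"
    "HOL-Algebra.QuotRing"
    "HOL-Algebra.Algebraic_Closure_Type"
begin

text \<open>
  A sequence indexed by the positive integers is represented as usual by a function on
  \<^typ>\<open>nat\<close>; the value at \<open>n\<close> is the term with index \<open>n + 1\<close>. This shift affects
  neither convergence nor limits nor the termwise operations below. The operations and
  relations are total functions on \<^typ>\<open>nat \<Rightarrow> real\<close>, but \<^const>\<open>lim\<close> is meaningful only on
  convergent sequences, so they are used on \<open>Rhat\<close> only.
\<close>

definition Rhat :: "(nat \<Rightarrow> real) set"
  where "Rhat = {x. convergent x}"

definition const_seq :: "real \<Rightarrow> nat \<Rightarrow> real"
  where "const_seq \<xi> = (\<lambda>n. \<xi>)"

definition shadow :: "(nat \<Rightarrow> real) \<Rightarrow> nat \<Rightarrow> real"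
  where "shadow x = const_seq (lim x)"

definition indiscernible :: "(nat \<Rightarrow> real) \<Rightarrow> (nat \<Rightarrow> real) \<Rightarrow> bool"  (infix \<open>\<approx>\<^sub>h\<close> 50)
  where "x \<approx>\<^sub>h y \<longleftrightarrow> shadow x = shadow y"

definition monad :: "(nat \<Rightarrow> real) \<Rightarrow> (nat \<Rightarrow> real) set"
  where "monad x = {y \<in> Rhat. y \<approx>\<^sub>h x}"

definition infinitesimals :: "(nat \<Rightarrow> real) set"
  where "infinitesimals = monad (const_seq 0)"

definition hat_add :: "(nat \<Rightarrow> real) \<Rightarrow> (nat \<Rightarrow> real) \<Rightarrow> nat \<Rightarrow> real"  (infixl \<open>+\<^sub>h\<close> 65)
  where "x +\<^sub>h y = (\<lambda>n. x n + y n)"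

definition hat_mult :: "(nat \<Rightarrow> real) \<Rightarrow> (nat \<Rightarrow> real) \<Rightarrow> nat \<Rightarrow> real"  (infixl \<open>\<cdot>\<^sub>h\<close> 70)
  where "x \<cdot>\<^sub>h y = (\<lambda>n. lim x * y n + lim y * x n - lim x * lim y)"

definition hat_less :: "(nat \<Rightarrow> real) \<Rightarrow> (nat \<Rightarrow> real) \<Rightarrow> bool"  (infix \<open><\<^sub>h\<close> 50)
  where "x <\<^sub>h y \<longleftrightarrow> lim x < lim y"

abbreviation hat_greater :: "(nat \<Rightarrow> real) \<Rightarrow> (nat \<Rightarrow> real) \<Rightarrow> bool"  (infix \<open>>\<^sub>h\<close> 50)
  where "x >\<^sub>h y \<equiv> y <\<^sub>h x"

definition Rhat_ring :: "(nat \<Rightarrow> real) ring"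
  where "Rhat_ring =
    \<lparr>carrier = Rhat, monoid.mult = hat_mult, one = const_seq 1, ring.zero = const_seq 0, add = hat_add\<rparr>"

abbreviation shadow_ring :: "(nat \<Rightarrow> real) ring"
  where "shadow_ring \<equiv> Rhat_ring\<lparr>carrier := shadow ` Rhat\<rparr>"

abbreviation real_ring :: "real ring"
  where "real_ring \<equiv> ring_of_type_algebra"

end

theory Submission
  imports Defs
begin

text \<open>
  A convergent sequence is its limit plus a null sequence, and \<open>\<cdot>\<^sub>h\<close> is the product of
  \<open>a + \<epsilon>\<close> and \<open>b + \<delta>\<close> with the term \<open>\<epsilon> \<delta>\<close> discarded: the ring is a square-zero
  extension of the reals by the null sequences. The limit is a ring homomorphism with square-zero
  kernel, so \<open>a + \<epsilon>\<close> is invertible exactly if \<open>a \<noteq> 0\<close>, the inverse being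
  \<open>1/a - \<epsilon>/a\<^sup>2\<close>.
\<close>

section \<open>Limits of the operations\<close>

lemma lim_const_seq [simp]: "lim (const_seq \<xi>) = \<xi>"
  by (simp add: const_seq_def)

lemma const_seq_in_Rhat [simp]: "const_seq \<xi> \<in> Rhat"
  by (simp add: Rhat_def const_seq_def convergent_const)

lemma Rhat_tendsto_lim: "x \<in> Rhat \<Longrightarrow> x \<longlonglongrightarrow> lim x"
  by (simp add: Rhat_def convergent_LIMSEQ_iff)

lemma Rhat_limI: "x \<longlonglongrightarrow> l \<Longrightarrow> x \<in> Rhat \<and> lim x = l"
  by (auto simp: Rhat_def convergent_def limI)

lemma
  assumes "x \<in> Rhat" "y \<in> Rhat"
  shows hat_add_closed [simp]: "x +\<^sub>h y \<in> Rhat"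
    and lim_hat_add [simp]: "lim (x +\<^sub>h y) = lim x + lim y"
proof -
  have "(x +\<^sub>h y) \<longlonglongrightarrow> lim x + lim y"
    unfolding hat_add_def by (intro tendsto_intros Rhat_tendsto_lim assms)
  then show "x +\<^sub>h y \<in> Rhat" "lim (x +\<^sub>h y) = lim x + lim y"
    by (simp_all add: Rhat_limI)
qed

text \<open>With limits a and b of the factors, the defining formula tends to ab + ba - ab = ab; so
  the limit is multiplicative although a term of the product is discarded.\<close>

lemma
  assumes "x \<in> Rhat" "y \<in> Rhat"
  shows hat_mult_closed [simp]: "x \<cdot>\<^sub>h y \<in> Rhat"
    and lim_hat_mult [simp]: "lim (x \<cdot>\<^sub>h y) = lim x * lim y"
proof -
  have "(x \<cdot>\<^sub>h y) \<longlonglongrightarrow> lim x * lim y + lim y * lim x - lim x * lim y"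
    unfolding hat_mult_def by (intro tendsto_intros Rhat_tendsto_lim assms)
  then show "x \<cdot>\<^sub>h y \<in> Rhat" "lim (x \<cdot>\<^sub>h y) = lim x * lim y"
    by (simp_all add: Rhat_limI)
qed

text \<open>Serves three constructions: additive inverses (\<open>c = -1\<close>), multiplicative
  inverses, and m-fold sums.\<close>

lemma
  assumes "x \<in> Rhat"
  shows scale_closed: "(\<lambda>n. c * x n) \<in> Rhat"
    and lim_scale: "lim (\<lambda>n. c * x n) = c * lim x"
proof -
  have "(\<lambda>n. c * x n) \<longlonglongrightarrow> c * lim x"
    by (intro tendsto_intros Rhat_tendsto_lim assms)
  then show "(\<lambda>n. c * x n) \<in> Rhat" "lim (\<lambda>n. c * x n) = c * lim x"
    by (simp_all add: Rhat_limI)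
qed

lemma Rhat_ring_sel [simp]:
  "carrier Rhat_ring = Rhat"
  "monoid.mult Rhat_ring = hat_mult"
  "one Rhat_ring = const_seq 1"
  "ring.zero Rhat_ring = const_seq 0"
  "add Rhat_ring = hat_add"
  by (simp_all add: Rhat_ring_def)

section \<open>The ring structure\<close>

lemma hat_add_assoc: "(x +\<^sub>h y) +\<^sub>h z = x +\<^sub>h (y +\<^sub>h z)"
  by (simp add: hat_add_def add.assoc)

lemma hat_add_commute: "x +\<^sub>h y = y +\<^sub>h x"
  by (simp add: hat_add_def add.commute)

lemma hat_add_zero: "const_seq 0 +\<^sub>h x = x"
  by (simp add: hat_add_def const_seq_def)

lemma const_seq_add: "const_seq (\<xi> + \<eta>) = const_seq \<xi> +\<^sub>h const_seq \<eta>"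
  by (simp add: const_seq_def hat_add_def)

lemma const_seq_mult: "const_seq (\<xi> * \<eta>) = const_seq \<xi> \<cdot>\<^sub>h const_seq \<eta>"
  by (simp add: hat_mult_def) (simp add: const_seq_def mult.commute)

lemma inj_const_seq: "inj const_seq"
  by (metis injI lim_const_seq)

lemma cring_Rhat_ring: "cring Rhat_ring"
proof (rule cringI)
  show "abelian_group Rhat_ring"
  proof (rule abelian_groupI)
    fix x assume x: "x \<in> carrier Rhat_ring"
    then show "\<exists>y\<in>carrier Rhat_ring. y \<oplus>\<^bsub>Rhat_ring\<^esub> x = \<zero>\<^bsub>Rhat_ring\<^esub>"
      using scale_closed[of x "-1"]
      by (intro bexI[of _ "\<lambda>n. - 1 * x n"]) (auto simp: hat_add_def const_seq_def)
  qed (simp_all add: hat_add_assoc hat_add_zero, simp add: hat_add_commute)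
  show "comm_monoid Rhat_ring"
  proof (rule comm_monoidI)
    fix x y z
    assume "x \<in> carrier Rhat_ring" "y \<in> carrier Rhat_ring" "z \<in> carrier Rhat_ring"
    then have "x \<in> Rhat" "y \<in> Rhat" "z \<in> Rhat"
      by simp_all
    \<comment> \<open>For factors a + \<epsilon>, b + \<delta>, c + \<zeta>, both bracketings give
      abc + bc \<epsilon> + ac \<delta> + ab \<zeta>. The unfolding is staged so that
      \<open>lim_hat_mult\<close> evaluates the limits of the inner products before these are
      unfolded.\<close>
    then have "(x \<cdot>\<^sub>h y) \<cdot>\<^sub>h z = x \<cdot>\<^sub>h (y \<cdot>\<^sub>h z)"
      by (subst (1 3) hat_mult_def) (simp, simp add: hat_mult_def algebra_simps)
    then show "(x \<otimes>\<^bsub>Rhat_ring\<^esub> y) \<otimes>\<^bsub>Rhat_ring\<^esub> z = x \<otimes>\<^bsub>Rhat_ring\<^esub> (y \<otimes>\<^bsub>Rhat_ring\<^esub> z)"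
      by simp
  next
    fix x assume "x \<in> carrier Rhat_ring"
    then show "\<one>\<^bsub>Rhat_ring\<^esub> \<otimes>\<^bsub>Rhat_ring\<^esub> x = x"
      by (simp add: hat_mult_def) (simp add: const_seq_def)
  next
    fix x y
    show "x \<otimes>\<^bsub>Rhat_ring\<^esub> y = y \<otimes>\<^bsub>Rhat_ring\<^esub> x"
      by (simp add: hat_mult_def algebra_simps)
  qed simp_all
next
  fix x y z
  assume "x \<in> carrier Rhat_ring" "y \<in> carrier Rhat_ring" "z \<in> carrier Rhat_ring"
  then have "x \<in> Rhat" "y \<in> Rhat" "z \<in> Rhat"
    by simp_all
  then have "(x +\<^sub>h y) \<cdot>\<^sub>h z = x \<cdot>\<^sub>h z +\<^sub>h y \<cdot>\<^sub>h z"
    by (simp add: hat_mult_def) (simp add: hat_add_def algebra_simps)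
  then show "(x \<oplus>\<^bsub>Rhat_ring\<^esub> y) \<otimes>\<^bsub>Rhat_ring\<^esub> z
      = x \<otimes>\<^bsub>Rhat_ring\<^esub> z \<oplus>\<^bsub>Rhat_ring\<^esub> y \<otimes>\<^bsub>Rhat_ring\<^esub> z"
    by simp
qed

section \<open>Shadow and infinitesimals\<close>

lemma shadow_hat_add: "x \<in> Rhat \<Longrightarrow> y \<in> Rhat \<Longrightarrow> shadow (x +\<^sub>h y) = shadow x +\<^sub>h shadow y"
  by (simp add: shadow_def const_seq_add)

lemma shadow_hat_mult: "x \<in> Rhat \<Longrightarrow> y \<in> Rhat \<Longrightarrow> shadow (x \<cdot>\<^sub>h y) = shadow x \<cdot>\<^sub>h shadow y"
  by (simp add: shadow_def const_seq_mult)

lemma shadow_const_seq [simp]: "shadow (const_seq \<xi>) = const_seq \<xi>"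
  by (simp add: shadow_def)

lemma shadow_ring_hom: "shadow \<in> ring_hom Rhat_ring Rhat_ring"
  by (rule ring_hom_memI) (simp_all add: shadow_hat_add shadow_hat_mult, simp add: shadow_def)

lemma shadow_image: "shadow ` Rhat = range const_seq"
proof
  show "range const_seq \<subseteq> shadow ` Rhat"
    by (metis const_seq_in_Rhat image_subsetI rev_image_eqI shadow_const_seq)
qed (auto simp: shadow_def)

lemma shadow_eq_iff: "shadow x = shadow y \<longleftrightarrow> lim x = lim y"
  by (auto simp: shadow_def inj_eq[OF inj_const_seq])

lemma infinitesimals_iff: "x \<in> infinitesimals \<longleftrightarrow> x \<in> Rhat \<and> lim x = 0"
  \<comment> \<open>\<open>shadow_const_seq\<close> would rewrite
    \<open>shadow (const_seq 0)\<close> and so hide the equation of two shadows that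
    \<open>shadow_eq_iff\<close> turns into one of limits.\<close>
  by (simp add: infinitesimals_def monad_def indiscernible_def shadow_eq_iff del: shadow_const_seq)

text \<open>The zero element is its own shadow, so having shadow zero and being indiscernible from
  zero are the same condition.\<close>

lemma a_kernel_shadow: "a_kernel Rhat_ring Rhat_ring shadow = infinitesimals"
  by (auto simp: a_kernel_def' infinitesimals_def monad_def indiscernible_def)

lemma ring_hom_ring_shadow: "ring_hom_ring Rhat_ring Rhat_ring shadow"
  using cring_Rhat_ring shadow_ring_hom by (auto intro: ring_hom_ringI2 cring.axioms(1))

text \<open>The infinitesimals are the kernel of the ring homomorphism
  \<open>shadow\<close>.\<close>

lemma ideal_infinitesimals: "ideal infinitesimals Rhat_ring"
  using ring_hom_ring.kernel_is_ideal[OF ring_hom_ring_shadow] by (simp add: a_kernel_shadow)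

lemma ex_nonzero_infinitesimal: "\<exists>x\<in>infinitesimals. x \<noteq> const_seq 0"
proof (rule bexI)
  \<comment> \<open>The sequence 1, 1/2, 1/3, ... in the shifted indexing; \<open>Suc\<close> avoids
    the term \<open>1 / 0\<close>, which is 0 in HOL.\<close>
  show "(\<lambda>n. 1 / real (Suc n)) \<in> infinitesimals"
    using Rhat_limI[OF lim_inverse_n'[THEN LIMSEQ_Suc]] by (simp add: infinitesimals_iff)
  show "(\<lambda>n. 1 / real (Suc n)) \<noteq> const_seq 0"
    by (auto simp: const_seq_def fun_eq_iff)
qed

text \<open>Each summand in the product formula carries a factor \<open>lim x\<close> or
  \<open>lim y\<close>.\<close>

lemma infinitesimals_mult_eq_zero:
  "x \<in> infinitesimals \<Longrightarrow> y \<in> infinitesimals \<Longrightarrow> x \<cdot>\<^sub>h y = const_seq 0"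
  by (simp add: infinitesimals_iff hat_mult_def const_seq_def)

lemma infinitesimals_square_zero:
  assumes "x \<in> infinitesimals"
  shows "x [^]\<^bsub>Rhat_ring\<^esub> (2::nat) = const_seq 0"
proof -
  interpret cring Rhat_ring
    by (rule cring_Rhat_ring)
  have "x \<in> carrier Rhat_ring"
    using assms by (simp add: infinitesimals_iff)
  then have "x [^]\<^bsub>Rhat_ring\<^esub> (2::nat) = x \<otimes>\<^bsub>Rhat_ring\<^esub> x"
    \<comment> \<open>With the record selectors kept folded, the power and unit laws of the
      interpreted ring still match.\<close>
    by (simp add: numeral_2_eq_2 del: Rhat_ring_sel)
  then show ?thesis
    using infinitesimals_mult_eq_zero[OF assms assms] by simp
qed

lemma Units_Rhat_ring_iff:
  assumes x: "x \<in> Rhat"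
  shows "x \<in> Units Rhat_ring \<longleftrightarrow> x \<notin> infinitesimals"
proof
  assume "x \<in> Units Rhat_ring"
  then obtain y where "y \<in> Rhat" "x \<cdot>\<^sub>h y = const_seq 1"
    by (auto simp: Units_def)
  \<comment> \<open>A homomorphism to the reals sends a unit to a nonzero number.\<close>
  then have "lim x * lim y = 1"
    using lim_hat_mult[OF x] lim_const_seq by metis
  then show "x \<notin> infinitesimals"
    by (auto simp: infinitesimals_iff)
next
  assume "x \<notin> infinitesimals"
  with x have nz: "lim x \<noteq> 0"
    by (simp add: infinitesimals_iff)
  define c where "c = 1 / lim x"
  have c: "lim x * c = 1"
    using nz by (simp add: c_def)
  \<comment> \<open>The inverse c - c^2 \<epsilon>, expressed through \<open>x\<close> itself by
    \<epsilon> = x - 1/c, which gives 2c - c^2 x.\<close>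
  define y where "y = const_seq (2 * c) +\<^sub>h (\<lambda>n. - (c * c) * x n)"
  have y: "y \<in> Rhat"
    unfolding y_def by (intro hat_add_closed const_seq_in_Rhat scale_closed x)
  have "lim y = 2 * c + - (c * c) * lim x"
    unfolding y_def by (simp only: lim_hat_add const_seq_in_Rhat scale_closed lim_scale lim_const_seq x)
  also have "\<dots> = 2 * c - c * (lim x * c)"
    by (simp add: algebra_simps)
  finally have lim_y: "lim y = c"
    by (simp add: c)
  have "lim x * y n + lim y * x n - lim x * lim y = 1" for n
  proof -
    \<comment> \<open>The right side is grouped around \<open>lim x * c\<close>, so that rewriting
      this to 1 cancels the terms in \<open>x n\<close>.\<close>
    have "lim x * y n + c * x n - lim x * c = 2 * (lim x * c) - (lim x * c) * c * x n + c * x n - lim x * c"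
      by (simp add: y_def hat_add_def const_seq_def algebra_simps)
    then show ?thesis
      by (simp add: c lim_y)
  qed
  then have "x \<cdot>\<^sub>h y = const_seq 1"
    by (simp add: hat_mult_def const_seq_def)
  moreover have "y \<cdot>\<^sub>h x = x \<cdot>\<^sub>h y"
    by (simp add: hat_mult_def algebra_simps)
  ultimately show "x \<in> Units Rhat_ring"
    using x y by (auto simp: Units_def)
qed

lemma add_pow_Rhat_ring:
  "add_pow Rhat_ring (m::nat) x = (\<lambda>n. real m * x n)"
  by (induction m) (simp_all add: add_pow_def nat_pow_def const_seq_def hat_add_def algebra_simps)

lemma Rhat_archimedean:
  assumes x: "x \<in> Rhat" and pos: "x >\<^sub>h const_seq 0"
  shows "\<exists>m::nat. m \<ge> 1 \<and> add_pow Rhat_ring m x >\<^sub>h y"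
proof -
  have "lim x > 0"
    using pos by (simp add: hat_less_def)
  then obtain m :: nat where "lim y < real m * lim x"
    using ex_less_of_nat_mult by blast
  \<comment> \<open>The multiple obtained may be 0, for instance if \<open>lim y\<close> is
    negative; passing to \<open>Suc m\<close> makes it positive.\<close>
  also have "\<dots> \<le> real (Suc m) * lim x"
    using \<open>lim x > 0\<close> by simp
  finally show ?thesis
    by (intro exI[of _ "Suc m"]) (simp add: add_pow_Rhat_ring hat_less_def lim_scale[OF x])
qed

text \<open>The carrier of \<open>shadow_ring\<close> is the range of \<open>const_seq\<close>, so
  bijectivity reduces to injectivity.\<close>

lemma const_seq_ring_iso: "const_seq \<in> ring_iso real_ring shadow_ring"
proof (rule ring_iso_memI)
  show "bij_betw const_seq (carrier real_ring) (carrier shadow_ring)"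
    using inj_const_seq by (simp add: bij_betw_def shadow_image ring_of_type_algebra_def)
qed (auto simp: ring_of_type_algebra_def shadow_image const_seq_add const_seq_mult)

lemma const_seq_ring_hom: "const_seq \<in> ring_hom real_ring Rhat_ring"
  by (rule ring_hom_memI)
    (simp_all add: ring_of_type_algebra_def const_seq_add const_seq_mult)

text \<open>The image of a commutative ring under a ring homomorphism is again one.\<close>

lemma cring_shadow_ring: "cring shadow_ring"
  using ring_hom_ring.img_is_cring[OF ring_hom_ring_shadow cring_Rhat_ring] by simp

theorem proposition2p3:
  shows
    \<comment> \<open>a)\<close>
    "cring Rhat_ring

     \<and> \<comment> \<open>b)\<close>
       (shadow \<in> ring_hom Rhat_ring Rhat_ring
      \<and> (\<forall>x\<in>Rhat. shadow (shadow x) = shadow x)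
      \<and> (\<forall>x\<in>Rhat. \<forall>y\<in>Rhat. shadow (x +\<^sub>h y) = shadow x +\<^sub>h shadow y)
      \<and> (\<forall>x\<in>Rhat. \<forall>y\<in>Rhat. shadow (x \<cdot>\<^sub>h y) = shadow x \<cdot>\<^sub>h shadow y)
      \<and> shadow (const_seq 1) = const_seq 1
      \<and> a_kernel Rhat_ring Rhat_ring shadow = monad (const_seq 0)
      \<and> shadow ` Rhat = {y \<in> Rhat. \<exists>\<xi>. y = const_seq \<xi>})

     \<and> \<comment> \<open>c)\<close>
       (ideal infinitesimals Rhat_ring
      \<and> infinitesimals \<noteq> {const_seq 0}
      \<and> (\<forall>x\<in>infinitesimals. \<forall>y\<in>infinitesimals. x +\<^sub>h y \<in> infinitesimals)
      \<and> (\<forall>x\<in>infinitesimals. \<ominus>\<^bsub>Rhat_ring\<^esub> x \<in> infinitesimals)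
      \<and> const_seq 0 \<in> infinitesimals
      \<and> (\<forall>x\<in>Rhat. \<forall>y\<in>infinitesimals. x \<cdot>\<^sub>h y \<in> infinitesimals)
      \<and> (\<exists>x\<in>infinitesimals. x \<noteq> const_seq 0))

     \<and> \<comment> \<open>d)\<close>
       ((\<forall>x\<in>infinitesimals. \<forall>y\<in>infinitesimals. x \<cdot>\<^sub>h y = const_seq 0)
      \<and> (\<forall>x\<in>infinitesimals. x \<cdot>\<^sub>h x = const_seq 0)
      \<and> (\<forall>x\<in>infinitesimals. \<exists>k::nat. k \<ge> 1 \<and> x [^]\<^bsub>Rhat_ring\<^esub> k = const_seq 0))

     \<and> \<comment> \<open>e)\<close>
       (\<forall>x\<in>Rhat. x \<in> Units Rhat_ring \<longleftrightarrow> x \<notin> infinitesimals)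

     \<and> \<comment> \<open>f)\<close>
       (\<forall>x\<in>Rhat. \<forall>y\<in>Rhat. \<forall>z\<in>Rhat.
          \<not> x <\<^sub>h x
        \<and> (x <\<^sub>h y \<and> y <\<^sub>h z \<longrightarrow> x <\<^sub>h z)
        \<and> (x <\<^sub>h y \<or> x \<approx>\<^sub>h y \<or> y <\<^sub>h x)
        \<and> (x <\<^sub>h y \<longrightarrow> x +\<^sub>h z <\<^sub>h y +\<^sub>h z)
        \<and> (x <\<^sub>h y \<and> z >\<^sub>h const_seq 0 \<longrightarrow> x \<cdot>\<^sub>h z <\<^sub>h y \<cdot>\<^sub>h z))

     \<and> \<comment> \<open>g)\<close>
       ((\<forall>x\<in>Rhat. add_pow Rhat_ring (1::nat) x = x)
      \<and> (\<forall>x\<in>Rhat. \<forall>y\<in>Rhat. x >\<^sub>h const_seq 0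
            \<longrightarrow> (\<exists>m::nat. m \<ge> 1 \<and> add_pow Rhat_ring m x >\<^sub>h y)))

     \<and> \<comment> \<open>h)\<close>
       (cring shadow_ring
      \<and> const_seq \<in> ring_iso real_ring shadow_ring
      \<and> (\<forall>\<xi> \<eta>. \<xi> < \<eta> \<longleftrightarrow> const_seq \<xi> <\<^sub>h const_seq \<eta>)
      \<and> const_seq \<in> ring_hom real_ring Rhat_ring
      \<and> inj const_seq)"
proof (intro conjI)
  show "cring Rhat_ring"
    by (rule cring_Rhat_ring)
  show "shadow \<in> ring_hom Rhat_ring Rhat_ring"
    by (rule shadow_ring_hom)
  show "a_kernel Rhat_ring Rhat_ring shadow = monad (const_seq 0)"
    using a_kernel_shadow by (simp add: infinitesimals_def)
  show "shadow ` Rhat = {y \<in> Rhat. \<exists>\<xi>. y = const_seq \<xi>}"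
    by (auto simp: shadow_image)
  show "ideal infinitesimals Rhat_ring"
    by (rule ideal_infinitesimals)
  show "infinitesimals \<noteq> {const_seq 0}" "\<exists>x\<in>infinitesimals. x \<noteq> const_seq 0"
    using ex_nonzero_infinitesimal by auto
  \<comment> \<open>The additive inverse of the ring is a definite description; the ideal laws give
    closure under it without computing it.\<close>
  interpret infinitesimals: ideal infinitesimals Rhat_ring
    by (rule ideal_infinitesimals)
  show "\<forall>x\<in>infinitesimals. \<ominus>\<^bsub>Rhat_ring\<^esub> x \<in> infinitesimals"
    using infinitesimals.a_inv_closed by blast
  show "\<forall>x\<in>infinitesimals. \<exists>k::nat. k \<ge> 1 \<and> x [^]\<^bsub>Rhat_ring\<^esub> k = const_seq 0"
    using infinitesimals_square_zero one_le_numeral by blast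
  show "\<forall>x\<in>Rhat. \<forall>y\<in>Rhat. \<forall>z\<in>Rhat.
          \<not> x <\<^sub>h x
        \<and> (x <\<^sub>h y \<and> y <\<^sub>h z \<longrightarrow> x <\<^sub>h z)
        \<and> (x <\<^sub>h y \<or> x \<approx>\<^sub>h y \<or> y <\<^sub>h x)
        \<and> (x <\<^sub>h y \<longrightarrow> x +\<^sub>h z <\<^sub>h y +\<^sub>h z)
        \<and> (x <\<^sub>h y \<and> z >\<^sub>h const_seq 0 \<longrightarrow> x \<cdot>\<^sub>h z <\<^sub>h y \<cdot>\<^sub>h z)"
    by (auto simp: hat_less_def indiscernible_def shadow_eq_iff)
  show "\<forall>x\<in>Rhat. \<forall>y\<in>Rhat. x >\<^sub>h const_seq 0
      \<longrightarrow> (\<exists>m::nat. m \<ge> 1 \<and> add_pow Rhat_ring m x >\<^sub>h y)"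
    using Rhat_archimedean by blast
  show "cring shadow_ring"
    by (rule cring_shadow_ring)
  show "const_seq \<in> ring_iso real_ring shadow_ring"
    by (rule const_seq_ring_iso)
  show "const_seq \<in> ring_hom real_ring Rhat_ring"
    by (rule const_seq_ring_hom)
  show "inj const_seq"
    by (rule inj_const_seq)
\<comment> \<open>The conjuncts left over reduce to real arithmetic with limits or to the termwise
  formulas.\<close>
qed (auto simp: const_seq_add const_seq_mult infinitesimals_iff
    infinitesimals_mult_eq_zero Units_Rhat_ring_iff add_pow_Rhat_ring hat_less_def shadow_def)

end
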